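(* Let $\alpha>-1$, $\gamma>-1$, $a>0$, $\beta>0$ and $u>0$. Then $$G^{1,1}_{1,2}\left[au\,\Big|\,{-1-\alpha\atop \gamma,\ -1-\alpha-\beta}\right]=\frac{a^{\gamma}}{\Gamma(\beta)}u^{-\beta-\alpha-1}\int_{0}^uv^{\alpha+\gamma+1}(u-v)^{\beta-1}e^{-av}\,dv$$ $$=\frac{a^{\gamma}}{\Gamma(\beta)}u^{\gamma}\int_0^1v^{\alpha+\gamma+1}(1-v)^{\beta-1}e^{-auv}\,dv$$ $$=a^{\gamma}\,\frac{\Gamma(2+\alpha+\gamma)}{\Gamma(2+\alpha+\gamma+\beta)}\,u^{\gamma}\,{}_1F_1(2+\alpha+\gamma;2+\alpha+\gamma+\beta;-au).$$
   Context: Meijer G-function: for $z>0$, $$G^{m,n}_{p,q}\left[z\,\Big|\,{a_1,\dots,a_p\atop b_1,\dots,b_q}\right]=\frac1{2\pi i}\int_{\kappa-i\infty}^{\kappa+i\infty}\frac{\prod_{j=1}^m\Gamma(b_j+s)\prod_{j=1}^n\Gamma(1-a_j-s)}{\prod_{j=m+1}^q\Gamma(1-b_j-s)\prod_{j=n+1}^p\Gamma(a_j+s)}\,z^{-s}\,ds,$$ where the real number $\kappa$ is such that all poles of $\Gamma(b_j+s)$, $j\le m$, lie to the left and all poles of $\Gamma(1-a_j-s)$, $j\le n$, lie to the right of the line $\Re s=\kappa$ (such $\kappa$ exists under the stated hypotheses). In the present case the integrand is $\frac{\Gamma(\gamma+s)\Gamma(2+\alpha-s)}{\Gamma(2+\alpha+\beta-s)}(au)^{-s}$.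 ${}_1F_1$ is the confluent hypergeometric series. *)

theory Defs
  imports "HOL-Complex_Analysis.Complex_Analysis"
begin

(* Parameter lists are indexed from 0, so b_j is bs ! (j - 1), and p = length as, q = length bs.
   Intended for m \<le> length bs and n \<le> length as.
   The library has Gamma x = 0 at the poles of Gamma and w / 0 = 0, so a factor 1 / Gamma takes
   its correct value 0 at those points. *)
definition meijer_integrand ::
    "nat \<Rightarrow> nat \<Rightarrow> complex list \<Rightarrow> complex list \<Rightarrow> real \<Rightarrow> complex \<Rightarrow> complex" where
  "meijer_integrand m n as bs z s =
     ((\<Prod>j<m. Gamma (bs ! j + s)) * (\<Prod>j<n. Gamma (1 - as ! j - s))) /
     ((\<Prod>j=m..<length bs. Gamma (1 - bs ! j - s)) * (\<Prod>j=n..<length as. Gamma (as ! j + s)))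
     * complex_of_real z powr (- s)"

definition separates_poles ::
    "nat \<Rightarrow> nat \<Rightarrow> complex list \<Rightarrow> complex list \<Rightarrow> real \<Rightarrow> bool" where
  "separates_poles m n as bs \<kappa> \<longleftrightarrow>
     (\<forall>j<m. \<forall>s. is_pole (\<lambda>s. Gamma (bs ! j + s)) s \<longrightarrow> Re s < \<kappa>) \<and>
     (\<forall>j<n. \<forall>s. is_pole (\<lambda>s. Gamma (1 - as ! j - s)) s \<longrightarrow> \<kappa> < Re s)"

(* The integral of f along the upward line Re s = \<kappa>, parametrised by s = \<kappa> + i t, ds = i dt.
   The gauge integral over the whole real line includes conditionally convergent improper
   integrals. *)
definition vertical_line_integral :: "(complex \<Rightarrow> complex) \<Rightarrow> real \<Rightarrow> complex" where
  "vertical_line_integral f \<kappa> = integral UNIV (\<lambda>t. f (Complex \<kappa> t) * \<i>)"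

(* The choice of \<kappa> is immaterial: it is an arbitrary abscissa separating the poles. *)
definition meijer_G :: "nat \<Rightarrow> nat \<Rightarrow> complex list \<Rightarrow> complex list \<Rightarrow> real \<Rightarrow> complex" where
  "meijer_G m n as bs z =
     1 / (2 * of_real pi * \<i>) *
     vertical_line_integral (meijer_integrand m n as bs z) (SOME \<kappa>. separates_poles m n as bs \<kappa>)"

definition hypergeom_1F1 :: "real \<Rightarrow> real \<Rightarrow> real \<Rightarrow> real" where
  "hypergeom_1F1 a b x = (\<Sum>k. pochhammer a k / pochhammer b k * x ^ k / fact k)"

end

theory Submission
  imports Defs "HOL-Probability.Levy"
begin

text \<open>The integrand of the G-function is \<open>\<Gamma>(\<gamma> + s) z\<^sup>-\<^sup>s\<close> times the quotient
\<open>\<Gamma>(2 + \<alpha> - s) / \<Gamma>(2 + \<alpha> + \<beta> - s)\<close>, where \<open>z = a u\<close>. Up to the factor \<open>1 / \<Gamma>(\<beta>)\<close> this quotient is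
Euler's beta integral \<open>\<integral>\<^sub>0\<^sup>1 v powr (1 + \<alpha> - s) (1 - v) powr (\<beta> - 1) dv\<close>, so the line integral becomes a double
integral over \<open>s\<close> and \<open>v\<close>. It converges absolutely: for \<open>s\<close> on the line \<open>Re s = \<kappa>\<close> the beta integrand has a
modulus that does not depend on \<open>s\<close>, and \<open>\<Gamma>\<close> is integrable along vertical lines. After exchanging the
two integrations, the integral over \<open>s\<close> is the Cahen-Mellin integral, which turns
\<open>\<Gamma>(\<gamma> + s) (z v)\<^sup>-\<^sup>s\<close> into \<open>2 \<pi> (z v) powr \<gamma> exp (- z v)\<close>. What remains is
\<open>z powr \<gamma> / \<Gamma>(\<beta>) \<integral>\<^sub>0\<^sup>1 v powr (\<alpha> + \<gamma> + 1) (1 - v) powr (\<beta> - 1) exp (- z v) dv\<close>, the middle expression of the theorem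
(lemma \<open>Mellin_Barnes_integral\<close>). The other two expressions follow by rescaling \<open>v\<close> and by expanding
the exponential and integrating term by term (lemma \<open>Euler_integral_1F1\<close>).

The Cahen-Mellin formula is Fourier inversion. If \<open>X\<close> has the gamma law with parameter \<open>c\<close>, then
\<open>ln X\<close> has the characteristic function \<open>t \<mapsto> \<Gamma>(c + i t) / \<Gamma>(c)\<close>, which is integrable, and so Levy's
inversion theorem recovers the density of \<open>ln X\<close> from it
(lemmas \<open>char_inversion_density\<close> and \<open>Cahen_Mellin\<close>).\<close>

section \<open>The gamma function on vertical lines\<close>

text \<open>Fubini's theorem and the theory of distributions need Euler's integral as a Lebesgue integral
with respect to \<open>lborel\<close>, rather than as a gauge integral.\<close>

lemma has_bochner_integral_Gamma:
  assumes "Re z > 0"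
  shows "has_bochner_integral lborel
    (\<lambda>x. indicator {0<..} x *\<^sub>R (complex_of_real x powr (z - 1) * of_real (exp (- x)))) (Gamma z)"
proof -
  define f where "f = (\<lambda>x::real. complex_of_real x powr (z - 1) / of_real (exp x))"
  have "integrable lebesgue (\<lambda>x. indicator {0<..} x *\<^sub>R f x)"
    using absolutely_integrable_Gamma_integral'[OF assms] by (simp add: f_def set_integrable_def)
  then have int: "set_integrable lborel {0<..} f"
    unfolding set_integrable_def f_def by (subst (asm) integrable_completion) auto
  have "(LINT x:{0<..}|lborel. f x) = integral {0<..} f"
    by (rule set_borel_integral_eq_integral[OF int])
  also have "\<dots> = Gamma z"
    using Gamma_integral_complex'[OF assms] by (simp add: f_def has_integral_iff)
  finally show ?thesis
    using int by (simp add: has_bochner_integral_iff set_integrable_def set_lebesgue_integral_def f_def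
        exp_minus divide_inverse of_real_inverse)
qed

lemma has_bochner_integral_Gamma_real:
  assumes "c > 0"
  shows "has_bochner_integral lborel
    (\<lambda>x. indicator {0<..} x * (x powr (c - 1) * exp (- x))) (Gamma c :: real)"
proof -
  have "has_bochner_integral lborel (\<lambda>x. Re (indicator {0<..} x *\<^sub>R
      (complex_of_real x powr (of_real c - 1) * of_real (exp (- x))))) (Re (Gamma (of_real c)))"
    by (intro has_bochner_integral_bounded_linear[OF bounded_linear_Re] has_bochner_integral_Gamma)
      (use assms in auto)
  also have "Re (Gamma (of_real c)) = Gamma c"
    by (simp add: Gamma_complex_of_real)
  also have "(\<lambda>x. Re (indicator {0<..} x *\<^sub>R (complex_of_real x powr (of_real c - 1) * of_real (exp (- x)))))
     = (\<lambda>x. indicator {0<..} x * (x powr (c - 1) * exp (- x)))"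
    using powr_of_real[of _ "c - 1"] by (auto simp: fun_eq_iff indicator_def)
  finally show ?thesis .
qed

lemma norm_Gamma_le:
  assumes "Re z > 0"
  shows "norm (Gamma z) \<le> Gamma (Re z)"
proof -
  let ?f = "\<lambda>x. indicator {0<..} x *\<^sub>R (complex_of_real x powr (z - 1) * of_real (exp (- x)))"
  have "norm (Gamma z) = norm (LINT x|lborel. ?f x)"
    using has_bochner_integral_Gamma[OF assms] by (simp add: has_bochner_integral_iff)
  also have "\<dots> \<le> (LINT x|lborel. norm (?f x))"
    by (rule integral_norm_bound)
  also have "\<dots> = (LINT x|lborel. indicator {0<..} x * (x powr (Re z - 1) * exp (- x)))"
    by (intro Bochner_Integration.integral_cong) (auto simp: indicator_def norm_mult norm_powr_real_powr)
  also have "\<dots> = Gamma (Re z)"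
    using has_bochner_integral_Gamma_real[OF assms] by (simp add: has_bochner_integral_iff)
  finally show ?thesis .
qed

lemma integrable_inverse_square_add_square:
  assumes "c > (0::real)"
  shows "integrable lborel (\<lambda>t. 1 / (c\<^sup>2 + t\<^sup>2))"
proof -
  have "integrable lborel (\<lambda>x::real. inverse (1 + x\<^sup>2))"
    using integrable_inverse_1_plus_square by (simp add: set_integrable_def)
  then have "integrable lborel (\<lambda>x::real. inverse (1 + (0 + (1/c) * x)\<^sup>2))"
    using assms by (intro lborel_integrable_real_affine) auto
  then have "integrable lborel (\<lambda>x::real. inverse (c\<^sup>2) * inverse (1 + (0 + (1/c) * x)\<^sup>2))"
    by (rule integrable_mult_right)
  also have "(\<lambda>x::real. inverse (c\<^sup>2) * inverse (1 + (0 + (1/c) * x)\<^sup>2)) = (\<lambda>t. 1 / (c\<^sup>2 + t\<^sup>2))"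
    using assms by (auto simp: fun_eq_iff field_simps power2_eq_square)
  finally show ?thesis .
qed

lemma Re_pos_notin_nonpos_Ints: "w \<notin> \<int>\<^sub>\<le>\<^sub>0" if "Re w > 0"
  using that by (auto elim!: nonpos_Ints_cases)

text \<open>Integrability along a vertical line does not need Stirling's formula: since
\<open>\<Gamma>(s + 2) = (s + 1) s \<Gamma>(s)\<close> and \<open>\<Gamma>(s + 2)\<close> is bounded by its value at the real part, two steps of the
functional equation already give quadratic decay.\<close>

lemma norm_Gamma_vertical_le:
  assumes "c > 0"
  shows "norm (Gamma (Complex c t)) \<le> Gamma (c + 2) * (1 / (c\<^sup>2 + t\<^sup>2))"
proof -
  let ?s = "Complex c t"
  have "Gamma (?s + 1 + 1) = (?s + 1) * (?s * Gamma ?s)"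
    using assms Gamma_plus1[OF Re_pos_notin_nonpos_Ints, of "?s + 1"] Gamma_plus1[OF Re_pos_notin_nonpos_Ints, of ?s] by simp
  then have "norm (Gamma (?s + 1 + 1)) = norm (?s + 1) * norm ?s * norm (Gamma ?s)"
    by (simp add: norm_mult)
  moreover have "norm (Gamma (?s + 1 + 1)) \<le> Gamma (c + 2)"
    using norm_Gamma_le[of "?s + 1 + 1"] assms by (simp add: add_ac)
  moreover have "norm ?s \<le> norm (?s + 1)"
    unfolding cmod_def using assms by (auto intro!: power_mono)
  then have "norm ?s * norm ?s \<le> norm (?s + 1) * norm ?s"
    by (intro mult_right_mono) auto
  moreover have "norm ?s * norm ?s = c\<^sup>2 + t\<^sup>2"
    by (simp add: cmod_def flip: power2_eq_square)
  ultimately have "(c\<^sup>2 + t\<^sup>2) * norm (Gamma ?s) \<le> Gamma (c + 2)"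
    by (metis (no_types, lifting) mult_right_mono norm_ge_zero order_trans)
  moreover have "c\<^sup>2 + t\<^sup>2 > 0" using assms by (simp add: add_pos_nonneg)
  ultimately show ?thesis by (simp add: field_simps)
qed

lemma continuous_on_Gamma_vertical:
  "c > 0 \<Longrightarrow> continuous_on UNIV (\<lambda>t. Gamma (Complex c t))"
  by (rule continuous_on_compose2[OF continuous_on_Gamma[of "{s. Re s > 0}"]])
    (auto elim!: nonpos_Ints_cases simp: Complex_eq intro!: continuous_intros)

lemma integrable_Gamma_vertical:
  assumes "c > 0"
  shows "integrable lborel (\<lambda>t. Gamma (Complex c t))"
proof (rule Bochner_Integration.integrable_bound)
  show "integrable lborel (\<lambda>t. Gamma (c + 2) * (1 / (c\<^sup>2 + t\<^sup>2)))"
    using assms by (intro integrable_mult_right integrable_inverse_square_add_square)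
  show "(\<lambda>t. Gamma (Complex c t)) \<in> borel_measurable lborel"
    using continuous_on_Gamma_vertical[OF assms] by (simp add: borel_measurable_continuous_onI)
  show "AE t in lborel. norm (Gamma (Complex c t)) \<le> norm (Gamma (c + 2) * (1 / (c\<^sup>2 + t\<^sup>2)))"
    by (intro AE_I2 order_trans[OF norm_Gamma_vertical_le[OF assms]]) (simp add: divide_right_mono)
qed

section \<open>Fourier inversion for integrable characteristic functions\<close>

text \<open>The kernel in Levy's inversion formula is bounded by \<open>b - a\<close>. Once the characteristic function is
integrable, dominated convergence therefore replaces the limit of truncated integrals by an
integral over the whole line.\<close>

lemma (in real_distribution) measure_Ioc_eq_char_integral:
  assumes "a \<le> b" "measure M {a} = 0" "measure M {b} = 0" and int: "integrable lborel (char M)"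
  shows "complex_of_real (measure M {a<..b}) =
    1 / (2 * pi) * (CLBINT t. (iexp (- (t * a)) - iexp (- (t * b))) / (\<i> * t) * char M t)"
proof -
  define F where "F = (\<lambda>t::real. (iexp (- (t * a)) - iexp (- (t * b))) / (\<i> * t) * char M t)"
  have [measurable]: "F \<in> borel_measurable borel"
    unfolding F_def by measurable
  have bound: "norm (F t) \<le> (b - a) * norm (char M t)" for t
  proof (cases "t = 0")
    case False
    have "norm ((iexp (t * (- a)) - iexp (t * (- b))) / (\<i> * t)) \<le> - a - (- b)"
      using assms(1) False by (intro Levy_Inversion_aux2) auto
    then have "norm ((iexp (- (t * a)) - iexp (- (t * b))) / (\<i> * t)) * norm (char M t) \<le> (b - a) * norm (char M t)"
      by (intro mult_right_mono) auto
    then show ?thesis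
      unfolding F_def by (simp only: norm_mult)
  qed (use assms(1) in \<open>simp add: F_def\<close>)
  have "(\<lambda>T::nat. (CLBINT t=-T..T. F t)) \<longlonglongrightarrow> (CLBINT t. F t)"
  proof -
    have "(\<lambda>T::nat. (CLBINT t. indicator {-real T<..<real T} t *\<^sub>R F t)) \<longlonglongrightarrow> (CLBINT t. F t)"
    proof (rule integral_dominated_convergence[where w = "\<lambda>t. (b - a) * norm (char M t)"])
      show "integrable lborel (\<lambda>t. (b - a) * norm (char M t))"
        using int by (intro integrable_mult_right integrable_norm)
      show "AE t in lborel. (\<lambda>T::nat. indicator {-real T<..<real T} t *\<^sub>R F t) \<longlonglongrightarrow> F t"
      proof (rule AE_I2, rule tendsto_eventually)
        fix t :: real
        show "\<forall>\<^sub>F T::nat in sequentially. indicator {-real T<..<real T} t *\<^sub>R F t = F t"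
          using eventually_gt_at_top[of "nat \<lceil>\<bar>t\<bar>\<rceil>"]
        proof eventually_elim
          case (elim T)
          then have "\<bar>t\<bar> < real T" by linarith
          then show ?case by (simp add: indicator_def abs_less_iff)
        qed
      qed
      show "AE t in lborel. norm (indicator {-real T<..<real T} t *\<^sub>R F t) \<le> (b - a) * norm (char M t)" for T :: nat
        using bound assms(1) by (auto intro!: AE_I2 simp: indicator_def)
    qed simp_all
    then show ?thesis
      by (simp add: interval_lebesgue_integral_def set_lebesgue_integral_def)
  qed
  from tendsto_mult[OF tendsto_const[of "complex_of_real (1 / (2 * pi))"] this]
  have "(\<lambda>T::nat. 1 / (2 * pi) * (CLBINT t=-T..T. F t)) \<longlonglongrightarrow> 1 / (2 * pi) * (CLBINT t. F t)" by simp
  moreover have "(\<lambda>T::nat. 1 / (2 * pi) * (CLBINT t=-T..T. F t)) \<longlonglongrightarrow> measure M {a<..b}"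
    using Levy_Inversion[OF assms(1-3)] by (simp add: F_def)
  ultimately show ?thesis
    unfolding F_def by (rule LIMSEQ_unique[OF _ , rotated])
qed

text \<open>Dividing the previous formula by the length of the interval gives a difference quotient of the
distribution function, and the kernel divided by this length is bounded by 1. Letting the
interval shrink to \<open>y\<close> is thus again a case of dominated convergence; the kernel becomes
the derivative of \<open>x \<mapsto> exp (- i t x) / (- i t)\<close> at \<open>y\<close>.\<close>

lemma (in real_distribution) char_inversion_density:
  assumes no_atoms: "\<And>x. measure M {x} = 0" and int: "integrable lborel (char M)"
    and deriv: "(cdf M has_real_derivative d) (at y)"
  shows "complex_of_real d = 1 / (2 * pi) * (CLBINT t. iexp (- (t * y)) * char M t)"
proof -
  define h where "h = (\<lambda>n. 1 / real (Suc n))"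
  define K where "K = (\<lambda>n t. (iexp (- (t * y)) - iexp (- (t * (y + h n)))) / (\<i> * of_real t) / of_real (h n))"
  have h: "h n > 0" "h \<longlonglongrightarrow> 0" for n
    using LIMSEQ_inverse_real_of_nat by (auto simp: h_def inverse_eq_divide)
  have "h n \<noteq> 0" for n
    using h(1)[of n] by simp
  then have h_at: "filterlim h (at 0) sequentially"
    and hc_at: "filterlim (\<lambda>n. complex_of_real (h n)) (at 0) sequentially"
    using h(2) tendsto_of_real[OF h(2), where 'a = complex] by (simp_all add: filterlim_at)
  have [measurable]: "K n \<in> borel_measurable borel" for n
    unfolding K_def by measurable
  have bound: "norm (K n t) \<le> 1" for n t
  proof (cases "t = 0")
    case False
    have "norm ((iexp (t * (- y)) - iexp (t * (- (y + h n)))) / (\<i> * t)) \<le> - y - (- (y + h n))"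
      using h(1)[of n] False by (intro Levy_Inversion_aux2) auto
    then have "norm ((iexp (- (t * y)) - iexp (- (t * (y + h n)))) / (\<i> * t)) \<le> h n"
      by (simp add: algebra_simps)
    then have "norm ((iexp (- (t * y)) - iexp (- (t * (y + h n)))) / (\<i> * t)) / h n \<le> 1"
      using h(1)[of n] by simp
    then show ?thesis
      using h(1)[of n] unfolding K_def by (simp only: norm_divide[of _ "of_real (h n)"] norm_of_real abs_of_pos)
  qed (simp add: K_def)
  have K_lim: "(\<lambda>n. K n t) \<longlonglongrightarrow> iexp (- (t * y))" if "t \<noteq> 0" for t
  proof -
    have "((\<lambda>w. exp (- (\<i> * t * w))) has_field_derivative (- (\<i> * t) * exp (- (\<i> * t * y)))) (at (of_real y))"
      by (auto intro!: derivative_eq_intros)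
    then have "(\<lambda>n. (exp (- (\<i> * t * (of_real y + of_real (h n)))) - exp (- (\<i> * t * of_real y))) / of_real (h n))
        \<longlonglongrightarrow> - (\<i> * t) * exp (- (\<i> * t * y))"
      by (rule filterlim_compose[OF _ hc_at, OF DERIV_D])
    from tendsto_mult[OF tendsto_const[of "- 1 / (\<i> * t)"] this]
    have "(\<lambda>n. - 1 / (\<i> * t) * ((exp (- (\<i> * t * (of_real y + of_real (h n)))) - exp (- (\<i> * t * of_real y))) / of_real (h n)))
        \<longlonglongrightarrow> iexp (- (t * y))"
      using that by (simp add: mult.assoc)
    moreover have "- 1 / w * ((E' - E) / k) = (E - E') / w / k" for w E E' k :: complex
      by (simp only: divide_inverse) (simp add: algebra_simps)
    then have "- 1 / (\<i> * t) * ((exp (- (\<i> * t * (of_real y + of_real (h n)))) - exp (- (\<i> * t * of_real y))) / of_real (h n))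
        = K n t" for n
      by (simp only: K_def of_real_mult of_real_add of_real_minus mult_minus_right mult.assoc)
    ultimately show ?thesis
      by (simp only:)
  qed
  have quot: "of_real ((cdf M (y + h n) - cdf M y) / h n) = 1 / (2 * pi) * (CLBINT t. K n t * char M t)" for n
  proof -
    have "cdf M (y + h n) - cdf M y = measure M {y<..y + h n}"
      using h(1) by (intro cdf_diff_eq) simp
    then have "of_real ((cdf M (y + h n) - cdf M y) / h n) =
      1 / (2 * pi) * ((CLBINT t. (iexp (- (t * y)) - iexp (- (t * (y + h n)))) / (\<i> * t) * char M t) / h n)"
      using measure_Ioc_eq_char_integral[OF _ no_atoms no_atoms int, of y "y + h n"] h(1)[of n] by simp
    also have "(CLBINT t. (iexp (- (t * y)) - iexp (- (t * (y + h n)))) / (\<i> * t) * char M t) / h n = (CLBINT t. K n t * char M t)"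
      by (subst integral_divide_zero[symmetric]) (simp add: K_def mult_ac)
    finally show ?thesis .
  qed
  have "(\<lambda>n. (CLBINT t. K n t * char M t)) \<longlonglongrightarrow> (CLBINT t. iexp (- (t * y)) * char M t)"
  proof (rule integral_dominated_convergence[where w = "\<lambda>t. norm (char M t)"])
    show "AE t in lborel. (\<lambda>n. K n t * char M t) \<longlonglongrightarrow> iexp (- (t * y)) * char M t"
      \<comment> \<open>At \<open>t = 0\<close> the kernel has the default value 0 instead of its limit, so this point is left out.\<close>
      using AE_lborel_singleton[of 0] by eventually_elim (intro tendsto_mult K_lim tendsto_const)
    show "AE t in lborel. norm (K n t * char M t) \<le> norm (char M t)" for n
      using bound by (auto intro!: AE_I2 mult_left_le_one_le simp: norm_mult)
  qed (use int in auto)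
  from tendsto_mult[OF tendsto_const[of "complex_of_real (1 / (2 * pi))"] this]
  have "(\<lambda>n. of_real ((cdf M (y + h n) - cdf M y) / h n)) \<longlonglongrightarrow> 1 / (2 * pi) * (CLBINT t. iexp (- (t * y)) * char M t)"
    by (simp only: quot)
  moreover have "(\<lambda>n. (cdf M (y + h n) - cdf M y) / h n) \<longlonglongrightarrow> d"
    using filterlim_compose[OF deriv[unfolded DERIV_def] h_at] .
  then have "(\<lambda>n. complex_of_real ((cdf M (y + h n) - cdf M y) / h n)) \<longlonglongrightarrow> of_real d"
    by (rule tendsto_of_real)
  ultimately show ?thesis by (rule LIMSEQ_unique[rotated])
qed

section \<open>The Cahen-Mellin integral\<close>

lemma of_real_powr_Complex:
  assumes "x > 0"
  shows "complex_of_real x powr (z + \<i> * of_real t) = of_real x powr z * iexp (t * ln x)"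
proof -
  have "complex_of_real x powr (z + \<i> * of_real t) = exp (z * of_real (ln x) + \<i> * of_real (t * ln x))"
    using assms by (simp add: powr_def Ln_of_real ring_distribs mult.assoc)
  then show ?thesis
    using assms by (simp add: powr_def Ln_of_real exp_add mult.assoc)
qed

text \<open>Below, \<open>N\<close> is the gamma law with parameter \<open>c\<close> and \<open>M\<close> the law of its logarithm. Passing to the
logarithm turns the Mellin transform of the gamma density, which is \<open>\<Gamma>\<close> up to a shift and the factor
\<open>1 / Gamma c\<close>, into a characteristic function; the density of \<open>M\<close> at \<open>y = ln x\<close> is \<open>x powr c * exp (- x) / Gamma c\<close>, and the formula says
that Fourier inversion gives it back.\<close>

theorem Cahen_Mellin:
  assumes c: "c > 0" and x: "x > 0"
  shows "(CLBINT t. Gamma (Complex c t) * complex_of_real x powr (- Complex c t)) = 2 * pi * exp (- x)"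
proof -
  let ?I = "CLBINT t. Gamma (Complex c t) * complex_of_real x powr (- Complex c t)"
  define f where "f = (\<lambda>x::real. x powr (c - 1) * exp (- x) / Gamma c)"
  define g where "g = (\<lambda>x. indicator {0<..} x * f x)"
  define N where "N = density lborel (\<lambda>x. ennreal (g x))"
  define M where "M = distr N borel ln"
  have Gc: "Gamma c > 0" using c by (rule Gamma_real_pos)
  have g_nonneg: "g x \<ge> 0" for x
    using Gc by (simp add: g_def f_def indicator_def)
  have [measurable]: "f \<in> borel_measurable borel" "g \<in> borel_measurable borel"
    unfolding f_def g_def by measurable
  have g_int: "has_bochner_integral lborel g 1"
  proof -
    have "has_bochner_integral lborel (\<lambda>x. indicator {0<..} x * (x powr (c - 1) * exp (- x)) / Gamma c) (Gamma c / Gamma c)"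
      by (rule has_bochner_integral_divide[OF has_bochner_integral_Gamma_real[OF c]])
    then show ?thesis
      using Gc by (simp add: g_def f_def)
  qed
  have [measurable_cong, simp]: "sets N = sets borel" and [simp]: "space N = UNIV"
    by (auto simp: N_def)
  interpret N: prob_space N
  proof
    have "emeasure N (space N) = (\<integral>\<^sup>+x. ennreal (g x) \<partial>lborel)"
      by (auto simp: N_def emeasure_density)
    also have "\<dots> = 1"
      using g_int g_nonneg by (subst nn_integral_eq_integral) (auto simp: has_bochner_integral_iff)
    finally show "emeasure N (space N) = 1" .
  qed
  interpret real_distribution M
    unfolding M_def by (rule N.real_distribution_distr) measurable
  have measure_N: "measure N A = (LINT x|lborel. g x * indicator A x)" if "A \<in> sets borel" for A
  proof -
    have "measure N A = (LINT x|N. indicator A x)"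
      using that by simp
    also have "\<dots> = (LINT x|lborel. g x * indicator A x)"
      unfolding N_def using that g_nonneg by (subst integral_density) auto
    finally show ?thesis .
  qed
  have measure_M: "measure M A = (LINT x|lborel. g x * indicator A (ln x))" if A: "A \<in> sets borel" for A
  proof -
    have "measure M A = measure N (ln -` A)"
      using A by (simp add: M_def measure_distr)
    moreover have "ln -` A \<in> sets borel"
      using measurable_sets[OF borel_measurable_ln[OF measurable_ident] A] by simp
    ultimately show ?thesis
      by (simp add: measure_N indicator_def)
  qed
  have char_M: "char M t = Gamma (Complex c t) / Gamma c" for t
  proof -
    have "char M t = (CLINT x|N. iexp (t * ln x))"
      by (simp add: char_def M_def integral_distr)
    also have "\<dots> = (CLBINT x. g x *\<^sub>R iexp (t * ln x))"
      using g_nonneg by (simp add: N_def integral_density)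
    also have "\<dots> = (CLBINT x. (indicator {0<..} x *\<^sub>R (complex_of_real x powr (Complex c t - 1) * of_real (exp (- x)))) / Gamma c)"
    proof (intro Bochner_Integration.integral_cong refl)
      fix x :: real
      show "g x *\<^sub>R iexp (t * ln x) = (indicator {0<..} x *\<^sub>R (complex_of_real x powr (Complex c t - 1) * of_real (exp (- x)))) / Gamma c"
      proof (cases "x > 0")
        case True
        have "Complex c t - 1 = of_real (c - 1) + \<i> * of_real t"
          by (simp add: complex_eq_iff)
        then have "complex_of_real x powr (Complex c t - 1) = of_real (x powr (c - 1)) * iexp (t * ln x)"
          using True powr_of_real[of x "c - 1"] by (simp only: of_real_powr_Complex less_imp_le)
        then show ?thesis
          using True by (simp only:) (simp add: g_def f_def scaleR_conv_of_real)
      qed (simp add: g_def)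
    qed
    also have "\<dots> = Gamma (Complex c t) / Gamma c"
      using has_bochner_integral_Gamma[of "Complex c t"] c by (simp add: has_bochner_integral_iff)
    finally show ?thesis .
  qed
  have no_atoms: "measure M {y} = 0" for y
  proof -
    have "measure M {y} = (LINT x|lborel. g x * indicator {y} (ln x))"
      by (rule measure_M) simp
    also have "\<dots> = (LINT (x::real)|lborel. 0)"
    proof (rule integral_cong_AE)
      show "AE x in lborel. g x * indicator {y} (ln x) = 0"
        using AE_lborel_singleton[of "exp y"] by eventually_elim (auto simp: g_def indicator_def)
    qed simp_all
    finally show ?thesis by simp
  qed
  define y where "y = ln x"
  have deriv: "(cdf M has_real_derivative (f x * x)) (at y)"
  proof -
    \<comment> \<open>The density \<open>f\<close> may be unbounded near 0; starting the integral at \<open>w\<close>, strictly between 0 and \<open>x\<close>,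
        keeps it continuous, so that the fundamental theorem of calculus applies.\<close>
    define w where "w = exp (y - 1)"
    have w: "0 < w" "w < x" "x = exp y"
    proof -
      show "x = exp y" using x by (simp add: y_def)
      then show "w < x" by (simp add: w_def)
    qed (simp add: w_def)
    have f_cont: "continuous_on {w..v} f" for v
      unfolding f_def using w(1) Gc by (intro continuous_intros) auto
    have cdf_eq: "cdf M b = cdf M (y - 1) + integral {w..exp b} f" if b: "b > y - 1" for b
    proof -
      have "cdf M b - cdf M (y - 1) = measure M {y - 1<..b}"
        using b by (intro cdf_diff_eq)
      also have "\<dots> = (LINT x|lborel. g x * indicator {y - 1<..b} (ln x))"
        by (rule measure_M) simp
      also have "\<dots> = (LINT x:{w..exp b}|lborel. f x)"
        unfolding set_lebesgue_integral_def
      proof (rule integral_cong_AE)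
        show "AE x in lborel. g x * indicator {y - 1<..b} (ln x) = indicator {w..exp b} x *\<^sub>R f x"
          using AE_lborel_singleton[of w]
        proof eventually_elim
          case (elim x)
          show ?case
          proof (cases "x > 0")
            case True
            then have "ln x \<in> {y - 1<..b} \<longleftrightarrow> x \<in> {w..exp b}"
              using elim ln_less_cancel_iff[OF w(1) True] ln_le_cancel_iff[OF True exp_gt_zero, of b]
              by (auto simp: w_def)
            then show ?thesis using True by (simp add: g_def indicator_def)
          next
            case False
            then show ?thesis using w by (simp add: g_def indicator_def)
          qed
        qed
      qed simp_all
      also have "\<dots> = integral {w..exp b} f"
        by (intro set_borel_integral_eq_integral borel_integrable_atLeastAtMost' f_cont)
      finally show ?thesis by simp
    qed
    have "((\<lambda>v. integral {w..v} f) has_real_derivative f x) (at x within {w..x + 1})"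
      using w by (intro integral_has_real_derivative f_cont) auto
    then have 1: "((\<lambda>v. integral {w..v} f) has_real_derivative f x) (at (exp y))"
      using w by (subst (asm) at_within_interior) auto
    have "((\<lambda>b. cdf M (y - 1) + integral {w..exp b} f) has_real_derivative (f x * x)) (at y)"
      using DERIV_chain2[OF 1 DERIV_exp] w by (auto intro!: derivative_eq_intros)
    then show ?thesis
    proof (rule has_field_derivative_transform_within_open)
      show "open {y - 1<..}" "y \<in> {y - 1<..}" by auto
    qed (simp add: cdf_eq)
  qed
  have "integrable lborel (char M)"
    using integrable_Gamma_vertical[OF c] by (auto simp: char_M[abs_def])
  from char_inversion_density[OF no_atoms this deriv]
  have "complex_of_real (f x * x) = 1 / (2 * pi) * (CLBINT t. iexp (- (t * y)) * char M t)" .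
  also have "(CLBINT t. iexp (- (t * y)) * char M t) = 
     (CLBINT t. of_real (x powr c / Gamma c) * (Gamma (Complex c t) * complex_of_real x powr (- Complex c t)))"
  proof (intro Bochner_Integration.integral_cong refl)
    fix t :: real
    have "complex_of_real x powr (- Complex c t) = complex_of_real x powr (- of_real c + \<i> * of_real (- t))"
      by (rule arg_cong2[where f = "(powr)"]) (auto simp: complex_eq_iff)
    also have "\<dots> = of_real (x powr (- c)) * iexp (- (t * y))"
      using powr_of_real[of x "- c"] x by (subst of_real_powr_Complex) (auto simp: y_def)
    finally have "of_real (x powr c) * complex_of_real x powr (- Complex c t) = of_real (x powr c * x powr (- c)) * iexp (- (t * y))"
      by (simp only: of_real_mult mult_ac)
    also have "x powr c * x powr (- c) = 1"
      using x by (simp flip: powr_add)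
    finally have "iexp (- (t * y)) = of_real (x powr c) * complex_of_real x powr (- Complex c t)"
      by simp
    then show "iexp (- (t * y)) * char M t = of_real (x powr c / Gamma c) * (Gamma (Complex c t) * complex_of_real x powr (- Complex c t))"
      by (simp add: char_M)
  qed
  also have "\<dots> = of_real (x powr c / Gamma c) * ?I"
    by (rule integral_mult_right_zero)
  finally have "complex_of_real (f x * x) = of_real (x powr c / Gamma c / (2 * pi)) * ?I"
    by simp
  also have "f x * x = x powr c / Gamma c / (2 * pi) * (2 * pi * exp (- x))"
    using x Gc by (simp add: f_def powr_diff)
  finally have "complex_of_real (x powr c / Gamma c / (2 * pi)) * (2 * pi * exp (- x)) =
      of_real (x powr c / Gamma c / (2 * pi)) * ?I"
    by simp
  moreover have "complex_of_real (x powr c / Gamma c / (2 * pi)) \<noteq> 0"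
    using x Gc by simp
  ultimately have "complex_of_real (2 * pi * exp (- x)) = ?I"
    by (rule mult_left_cancel[THEN iffD1, rotated])
  then show ?thesis by (rule sym)
qed

section \<open>The beta integral with a complex argument\<close>

text \<open>The classical proof for real arguments carries over. The product \<open>\<Gamma>(p) \<Gamma>(b)\<close> is the integral of
\<open>x powr (p - 1) * (w - x) powr (b - 1) * exp (- w)\<close> over \<open>0 < x < w\<close>: integrating over \<open>w\<close> first and
shifting by \<open>x\<close> separates the two gamma integrals, while integrating over \<open>x\<close> first and scaling by
\<open>w\<close> gives \<open>\<Gamma>(p + b)\<close> times the beta integral. The first order of integration, applied to absolute
values, also justifies the exchange.\<close>

lemma has_bochner_integral_Beta_complex:
  assumes p: "Re p > 0" and b: "b > 0"
  shows "has_bochner_integral lborel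
    (\<lambda>v. indicator {0<..<1} v *\<^sub>R (complex_of_real v powr (p - 1) * of_real ((1 - v) powr (b - 1))))
    (Beta p (of_real b))"
proof -
  define P where "P = (\<lambda>x::real. indicator {0<..} x *\<^sub>R complex_of_real x powr (p - 1))"
  define q where "q = (\<lambda>y::real. indicator {0<..} y * y powr (b - 1))"
  define F where "F = (\<lambda>x w. P x * of_real (q (w - x) * exp (- w)))"
  have [measurable]: "P \<in> borel_measurable borel" "q \<in> borel_measurable borel"
    unfolding P_def q_def by measurable
  have F_meas: "case_prod F \<in> borel_measurable (lborel \<Otimes>\<^sub>M lborel)"
    unfolding F_def by measurable
  have q_int: "has_bochner_integral lborel (\<lambda>y. q y * exp (- y)) (Gamma b)"
    using has_bochner_integral_Gamma_real[OF b] by (simp add: q_def mult_ac)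
  have q_shift: "has_bochner_integral lborel (\<lambda>w. q (w - x) * exp (- w)) (exp (- x) * Gamma b)" for x
  proof -
    have "has_bochner_integral lborel (\<lambda>w. q (- x + 1 * w) * exp (- (- x + 1 * w))) (Gamma b /\<^sub>R \<bar>1\<bar>)"
      using q_int by (subst (asm) lborel_has_bochner_integral_real_affine_iff[of 1 _ _ "- x"]) simp_all
    then have "has_bochner_integral lborel (\<lambda>w. exp (- x) * (q (- x + 1 * w) * exp (- (- x + 1 * w)))) (exp (- x) * (Gamma b /\<^sub>R \<bar>1\<bar>))"
      by (rule has_bochner_integral_mult_right)
    then show ?thesis
      by (simp add: exp_diff exp_minus field_simps)
  qed
  have P_int: "has_bochner_integral lborel (\<lambda>x. P x * of_real (exp (- x))) (Gamma p)"
    using has_bochner_integral_Gamma[OF p] by (simp add: P_def)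
  have inner_w: "has_bochner_integral lborel (\<lambda>w. F x w) (P x * of_real (exp (- x) * Gamma b))" for x
    unfolding F_def by (intro has_bochner_integral_mult_right has_bochner_integral_of_real q_shift)
  have F_int: "integrable (lborel \<Otimes>\<^sub>M lborel) (case_prod F)"
  proof (rule lborel_pair.Fubini_integrable[OF F_meas])
    show "AE x in lborel. integrable lborel (\<lambda>w. case_prod F (x, w))"
      using inner_w by (auto simp: has_bochner_integral_iff)
    have "(LINT w|lborel. norm (F x w)) = norm (P x * of_real (exp (- x))) * Gamma b" for x
    proof -
      have "(LINT w|lborel. norm (F x w)) = (LINT w|lborel. norm (P x) * (q (w - x) * exp (- w)))"
        by (intro Bochner_Integration.integral_cong) (auto simp: F_def norm_mult q_def)
      also have "\<dots> = norm (P x) * (exp (- x) * Gamma b)"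
        using q_shift[of x] by (simp add: has_bochner_integral_iff)
      finally show ?thesis by (simp add: norm_mult)
    qed
    then show "integrable lborel (\<lambda>x. LINT w|lborel. norm (case_prod F (x, w)))"
      using P_int by (auto simp: has_bochner_integral_iff intro!: integrable_mult_left integrable_norm)
  qed
  define B where "B = (CLBINT v. P v * of_real (q (1 - v)))"
  have inner_x: "(CLBINT x. F x w) = indicator {0<..} w *\<^sub>R (complex_of_real w powr (p + of_real b - 1) * of_real (exp (- w))) * B" for w
  proof (cases "w > 0")
    case True
    have "(CLBINT x. F x w) = \<bar>w\<bar> *\<^sub>R (CLBINT v. F (0 + w * v) w)"
      using True by (intro lborel_integral_real_affine) auto
    also have "(CLBINT v. F (0 + w * v) w) =
        (CLBINT v. complex_of_real w powr (p - 1) * of_real (w powr (b - 1) * exp (- w)) * (P v * of_real (q (1 - v))))"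
    proof (intro Bochner_Integration.integral_cong refl)
      fix v :: real
      have "P (w * v) = complex_of_real w powr (p - 1) * P v"
        using True by (cases "v > 0") (auto simp: P_def indicator_def powr_times_real zero_less_mult_iff)
      moreover have "q (w - w * v) = w powr (b - 1) * q (1 - v)"
      proof -
        have "w - w * v = w * (1 - v)" by (simp add: algebra_simps)
        then show ?thesis
          using True by (cases "v < 1") (auto simp: q_def indicator_def powr_mult zero_less_mult_iff)
      qed
      ultimately show "F (0 + w * v) w = complex_of_real w powr (p - 1) * of_real (w powr (b - 1) * exp (- w)) * (P v * of_real (q (1 - v)))"
        by (simp add: F_def mult_ac)
    qed
    also have "\<dots> = complex_of_real w powr (p - 1) * of_real (w powr (b - 1) * exp (- w)) * B"
      unfolding B_def by (rule integral_mult_right_zero)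
    also have "\<bar>w\<bar> *\<^sub>R \<dots> = (of_real w * complex_of_real w powr (p - 1) * of_real (w powr (b - 1))) * of_real (exp (- w)) * B"
      using True by (simp add: scaleR_conv_of_real mult_ac)
    also have "of_real w * complex_of_real w powr (p - 1) * of_real (w powr (b - 1)) = complex_of_real w powr (1 + (p - 1) + of_real (b - 1))"
      using True powr_of_real[of w "b - 1"] by (simp only: powr_add) (simp)
    also have "1 + (p - 1) + of_real (b - 1) = p + of_real b - 1" by simp
    finally show ?thesis using True by simp
  next
    case False
    have "F x w = 0" for x
      using False by (auto simp: F_def P_def q_def indicator_def)
    then show ?thesis using False by simp
  qed
  have pb: "Re (p + of_real b) > 0" using p b by simp
  have "Gamma p * of_real (Gamma b) = (CLBINT x. (P x * of_real (exp (- x))) * of_real (Gamma b))"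
    using P_int by (simp add: has_bochner_integral_iff)
  also have "\<dots> = (CLBINT x. (CLBINT w. F x w))"
    using inner_w by (simp add: has_bochner_integral_iff mult.assoc)
  also have "\<dots> = (CLBINT w. (CLBINT x. F x w))"
    by (rule lborel_pair.Fubini_integral[OF F_int, symmetric])
  also have "\<dots> = Gamma (p + of_real b) * B"
    unfolding inner_x
    by (intro has_bochner_integral_integral_eq has_bochner_integral_mult_left has_bochner_integral_Gamma pb)
  finally have "Gamma p * of_real (Gamma b) = Gamma (p + of_real b) * B" .
  moreover have "Gamma (p + of_real b) \<noteq> 0"
    using Re_pos_notin_nonpos_Ints[OF pb] by (simp add: Gamma_eq_zero_iff)
  ultimately have B: "B = Beta p (of_real b)"
    by (simp add: Beta_def Gamma_complex_of_real field_simps)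
  have "integrable lborel (\<lambda>v. P v * of_real (q (1 - v)))"
  proof (rule Bochner_Integration.integrable_bound)
    show "integrable lborel (\<lambda>v. indicator {0..1} v *\<^sub>R (v powr (Re p - 1) * (1 - v) powr (b - 1)))"
      using integrable_Beta[OF p b] by (simp add: set_integrable_def)
    show "AE v in lborel. norm (P v * of_real (q (1 - v))) \<le> norm (indicator {0..1} v *\<^sub>R (v powr (Re p - 1) * (1 - v) powr (b - 1)))"
      by (intro AE_I2) (auto simp: P_def q_def indicator_def norm_mult norm_powr_real_powr)
  qed measurable
  then have "has_bochner_integral lborel (\<lambda>v. P v * of_real (q (1 - v))) (Beta p (of_real b))"
    using B by (simp add: B_def has_bochner_integral_iff)
  also have "(\<lambda>v. P v * of_real (q (1 - v))) = (\<lambda>v. indicator {0<..<1} v *\<^sub>R (complex_of_real v powr (p - 1) * of_real ((1 - v) powr (b - 1))))"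
    by (auto simp: P_def q_def indicator_def fun_eq_iff)
  finally show ?thesis .
qed

section \<open>A Mellin-Barnes integral\<close>

text \<open>Writing the quotient of gamma functions as a beta integral makes the integral of \<open>F\<close> the
integral of \<open>H t v\<close> over \<open>t\<close> and \<open>v\<close>, divided by \<open>Gamma \<beta>\<close>. The powers with complex exponents enter \<open>H\<close> as a modulus
times \<open>iexp\<close> phases, so that \<open>norm (H t v)\<close> is a product of an integrable function of \<open>t\<close> and one of
\<open>v\<close>. Integrating over \<open>t\<close> first leads to the Cahen-Mellin integral on the line with real part
\<open>c = \<gamma> + \<kappa>\<close>, which is positive exactly because \<open>\<kappa>\<close> lies to the right of the poles of \<open>\<Gamma>(\<gamma> + s)\<close>.\<close>

lemma Mellin_Barnes_integral:
  fixes \<alpha> \<beta> \<gamma> \<kappa> z :: real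
  defines "F \<equiv> \<lambda>s. Gamma (of_real \<gamma> + s) * Gamma (of_real (2 + \<alpha>) - s) /
      Gamma (of_real (2 + \<alpha> + \<beta>) - s) * complex_of_real z powr (- s)"
  assumes \<kappa>: "- \<gamma> < \<kappa>" "\<kappa> < 2 + \<alpha>" and \<beta>: "\<beta> > 0" and z: "z > 0"
  shows "has_bochner_integral lborel (\<lambda>t. F (Complex \<kappa> t))
    (of_real (2 * pi * (z powr \<gamma> / Gamma \<beta> *
      (LINT v:{0..1}|lborel. v powr (\<alpha> + \<gamma> + 1) * (1 - v) powr (\<beta> - 1) * exp (- z * v)))))"
proof -
  define c where "c = \<gamma> + \<kappa>"
  define G where "G = (\<lambda>t. Gamma (Complex c t))"
  define w where "w = (\<lambda>v::real. indicator {0<..<1} v * (v powr (1 + \<alpha> - \<kappa>) * (1 - v) powr (\<beta> - 1)))"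
  define H where "H = (\<lambda>t v. G t * (of_real (z powr (- \<kappa>) * w v) * (iexp (- t * ln z) * iexp (- t * ln v))))"
  have c: "c > 0" using \<kappa> by (simp add: c_def)
  have G_int: "integrable lborel G"
    unfolding G_def by (rule integrable_Gamma_vertical[OF c])
  then have [measurable]: "G \<in> borel_measurable borel" by auto
  have [measurable]: "w \<in> borel_measurable borel"
    unfolding w_def by measurable
  have H_meas: "case_prod H \<in> borel_measurable (lborel \<Otimes>\<^sub>M lborel)"
    unfolding H_def by measurable
  have norm_H: "norm (H t v) = norm (G t) * (z powr (- \<kappa>) * w v)" for t v
    by (simp add: H_def norm_mult w_def)
  have w_int: "integrable lborel w"
  proof (rule Bochner_Integration.integrable_bound)
    show "integrable lborel (\<lambda>v. indicator {0..1} v *\<^sub>R (v powr (1 + \<alpha> - \<kappa>) * (1 - v) powr (\<beta> - 1)))"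
      using integrable_Beta[of "1 + (1 + \<alpha> - \<kappa>)" \<beta>, OF _ \<beta>] \<kappa>
      by (simp only: set_integrable_def add_diff_cancel_left')
    show "AE v in lborel. norm (w v) \<le> norm (indicator {0..1} v *\<^sub>R (v powr (1 + \<alpha> - \<kappa>) * (1 - v) powr (\<beta> - 1)))"
      by (intro AE_I2) (auto simp: w_def indicator_def)
  qed measurable
  have H_int: "integrable (lborel \<Otimes>\<^sub>M lborel) (case_prod H)"
  proof (rule lborel_pair.Fubini_integrable[OF H_meas])
    show "AE t in lborel. integrable lborel (\<lambda>v. case_prod H (t, v))"
    proof (rule AE_I2)
      fix t
      show "integrable lborel (\<lambda>v. case_prod H (t, v))"
      proof (rule Bochner_Integration.integrable_bound)
        show "integrable lborel (\<lambda>v. norm (G t) * (z powr (- \<kappa>) * w v))"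
          by (intro integrable_mult_right w_int)
        show "(\<lambda>v. case_prod H (t, v)) \<in> borel_measurable lborel"
          unfolding H_def prod.case by measurable
        show "AE v in lborel. norm (case_prod H (t, v)) \<le> norm (norm (G t) * (z powr (- \<kappa>) * w v))"
          unfolding prod.case norm_H by (intro AE_I2) simp
      qed
    qed
    show "integrable lborel (\<lambda>t. LINT v|lborel. norm (case_prod H (t, v)))"
      unfolding prod.case norm_H using G_int by simp
  qed
  have inner_v: "(CLBINT v. H t v) = of_real (Gamma \<beta>) * F (Complex \<kappa> t)" for t
  proof -
    define p where "p = of_real (2 + \<alpha>) - Complex \<kappa> t"
    have p: "Re p > 0" using \<kappa> by (simp add: p_def)
    have zk: "complex_of_real z powr (- Complex \<kappa> t) = of_real (z powr (- \<kappa>)) * iexp (- t * ln z)"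
    proof -
      have "- Complex \<kappa> t = of_real (- \<kappa>) + \<i> * of_real (- t)"
        by (simp add: complex_eq_iff)
      then show ?thesis
        using z powr_of_real[of z "- \<kappa>"] by (simp only: of_real_powr_Complex less_imp_le)
    qed
    have "H t v = G t * complex_of_real z powr (- Complex \<kappa> t) *
        (indicator {0<..<1} v *\<^sub>R (complex_of_real v powr (p - 1) * of_real ((1 - v) powr (\<beta> - 1))))" for v
    proof (cases "v \<in> {0<..<1}")
      case True
      have "p - 1 = of_real (1 + \<alpha> - \<kappa>) + \<i> * of_real (- t)"
        by (simp add: complex_eq_iff p_def)
      then have "complex_of_real v powr (p - 1) = of_real (v powr (1 + \<alpha> - \<kappa>)) * iexp (- t * ln v)"
        using True powr_of_real[of v "1 + \<alpha> - \<kappa>"] by (simp only: of_real_powr_Complex less_imp_le greaterThanLessThan_iff)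
      then show ?thesis
        using True unfolding zk by (simp only:) (simp add: H_def w_def mult_ac)
    qed (simp add: H_def w_def)
    then have "(CLBINT v. H t v) = G t * complex_of_real z powr (- Complex \<kappa> t) * Beta p (of_real \<beta>)"
      by (simp only:)
        (intro has_bochner_integral_integral_eq has_bochner_integral_mult_right has_bochner_integral_Beta_complex p \<beta>)
    moreover have "of_real \<gamma> + Complex \<kappa> t = Complex c t"
      by (simp add: c_def complex_eq_iff)
    moreover have "of_real (2 + \<alpha> + \<beta>) - Complex \<kappa> t = p + of_real \<beta>"
      by (simp add: p_def)
    ultimately show ?thesis
      by (simp only: F_def G_def Beta_def p_def[symmetric] Gamma_complex_of_real
          times_divide_eq_left times_divide_eq_right mult_ac)
  qed
  have inner_t: "(CLBINT t. H t v) = of_real (2 * pi * z powr \<gamma>) *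
      of_real (indicator {0..1} v *\<^sub>R (v powr (\<alpha> + \<gamma> + 1) * (1 - v) powr (\<beta> - 1) * exp (- z * v)))" for v
  proof (cases "v \<in> {0<..<1}")
    case True
    then have zv: "z * v > 0" using z by simp
    define k where "k = (z * v) powr \<gamma> * (v powr (1 + \<alpha>) * (1 - v) powr (\<beta> - 1))"
    have "H t v = of_real k * (Gamma (Complex c t) * complex_of_real (z * v) powr (- Complex c t))" for t
    proof -
      have "- Complex c t = of_real (- c) + \<i> * of_real (- t)"
        by (simp add: complex_eq_iff)
      then have "complex_of_real (z * v) powr (- Complex c t) = of_real ((z * v) powr (- c)) * iexp (- t * ln (z * v))"
        using zv powr_of_real[of "z * v" "- c"] by (simp only: of_real_powr_Complex less_imp_le)
      also have "iexp (- t * ln (z * v)) = iexp (- t * ln z) * iexp (- t * ln v)"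
        using z True by (simp add: ln_mult ring_distribs flip: exp_add)
      finally have "of_real k * (Gamma (Complex c t) * complex_of_real (z * v) powr (- Complex c t)) =
          G t * (of_real (k * (z * v) powr (- c)) * (iexp (- t * ln z) * iexp (- t * ln v)))"
        by (simp only: G_def of_real_mult mult_ac)
      also have "k * (z * v) powr (- c) = z powr (- \<kappa>) * w v"
      proof -
        have "(z * v) powr \<gamma> * (z * v) powr (- c) = z powr (- \<kappa>) * v powr (- \<kappa>)"
          using z True powr_add[of "z * v" \<gamma> "- c"] by (simp add: c_def powr_mult)
        moreover have "v powr (- \<kappa>) * v powr (1 + \<alpha>) = v powr (1 + \<alpha> - \<kappa>)"
          using powr_add[of v "- \<kappa>" "1 + \<alpha>"] by (simp add: algebra_simps)
        ultimately show ?thesis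
          using True by (simp add: k_def w_def mult_ac)
      qed
      finally show ?thesis by (simp only: H_def)
    qed
    then have "(CLBINT t. H t v) = of_real k * (2 * pi * exp (- (z * v)))"
      using Cahen_Mellin[OF c zv] by simp
    also have "k = z powr \<gamma> * (v powr (\<alpha> + \<gamma> + 1) * (1 - v) powr (\<beta> - 1))"
      using z True by (simp add: k_def powr_mult powr_add mult_ac)
    finally show ?thesis
      using True by (simp add: mult_ac)
  next
    case False
    \<comment> \<open>At the end points the powers vanish, because \<open>0 powr _ = 0\<close>.\<close>
    then have "indicator {0..1} v *\<^sub>R (v powr (\<alpha> + \<gamma> + 1) * (1 - v) powr (\<beta> - 1) * exp (- z * v)) = 0"
      by (auto simp: indicator_def)
    moreover have "H t v = 0" for t
      using False by (simp add: H_def w_def)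
    ultimately show ?thesis by simp
  qed
  have G\<beta>: "Gamma \<beta> > 0" using \<beta> by (rule Gamma_real_pos)
  have "integrable lborel (\<lambda>t. CLBINT v. H t v)"
    using lborel_pair.integrable_fst'[OF H_int] by simp
  moreover have "(CLBINT t. CLBINT v. H t v) = (CLBINT v. CLBINT t. H t v)"
    by (rule lborel_pair.Fubini_integral[OF H_int, symmetric])
  moreover have "(CLBINT v. CLBINT t. H t v) = of_real (2 * pi * z powr \<gamma> *
      (LINT v:{0..1}|lborel. v powr (\<alpha> + \<gamma> + 1) * (1 - v) powr (\<beta> - 1) * exp (- z * v)))"
    unfolding inner_t set_lebesgue_integral_def
    by (subst integral_mult_right_zero, subst integral_complex_of_real) (simp only: of_real_mult)
  ultimately have "has_bochner_integral lborel (\<lambda>t. CLBINT v. H t v) (of_real (2 * pi * z powr \<gamma> *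
      (LINT v:{0..1}|lborel. v powr (\<alpha> + \<gamma> + 1) * (1 - v) powr (\<beta> - 1) * exp (- z * v))))"
    by (simp only: has_bochner_integral_iff)
  from has_bochner_integral_divide_zero[OF this, of "of_real (Gamma \<beta>)"] G\<beta> show ?thesis
    unfolding inner_v by (simp add: mult.assoc)
qed

section \<open>Euler's integral for the confluent hypergeometric function\<close>

lemma set_integral_Beta:
  assumes "a > 0" "b > (0::real)"
  shows "(LINT t:{0..1}|lborel. t powr (a - 1) * (1 - t) powr (b - 1)) = Beta a b"
  using set_borel_integral_eq_integral(2)[OF integrable_Beta[OF assms]] has_integral_Beta_real[OF assms]
  by (simp add: integral_unique)

lemma Beta_plus_of_nat_left:
  assumes "a > 0" "b > (0::real)"
  shows "Beta (a + real k) b = Beta a b * (pochhammer a k / pochhammer (a + b) k)"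
proof -
  have "a \<notin> \<int>\<^sub>\<le>\<^sub>0" "a + b \<notin> \<int>\<^sub>\<le>\<^sub>0"
    using assms by (auto elim!: nonpos_Ints_cases)
  moreover have "Gamma a > 0" "Gamma (a + b) > 0"
    using assms by (auto intro: Gamma_real_pos)
  ultimately show ?thesis
    by (simp add: pochhammer_Gamma Beta_def add_ac)
qed

text \<open>Each term of the exponential series contributes a beta integral with first argument \<open>a + k\<close>, and
these are bounded by \<open>Beta a b\<close>. So the integrals of the absolute values are dominated by an
exponential series, which allows termwise integration.\<close>

lemma Euler_integral_1F1:
  assumes a: "a > 0" and b: "b > 0"
  shows "set_integrable lborel {0..1} (\<lambda>v. v powr (a - 1) * (1 - v) powr (b - 1) * exp (x * v))"
    and "(LINT v:{0..1}|lborel. v powr (a - 1) * (1 - v) powr (b - 1) * exp (x * v)) =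
      Beta a b * hypergeom_1F1 a (a + b) x"
proof -
  define f where "f = (\<lambda>k v. (x ^ k / fact k) * (indicator {0..1} v *\<^sub>R (v powr (a + real k - 1) * (1 - v) powr (b - 1))))"
  have int: "integrable lborel (f k)" for k
    unfolding f_def using integrable_Beta[of "a + real k" b] a b
    by (intro integrable_mult_right) (simp add: set_integrable_def)
  have abs_f: "norm (f k v) = (\<bar>x\<bar> ^ k / fact k) * (indicator {0..1} v *\<^sub>R (v powr (a + real k - 1) * (1 - v) powr (b - 1)))" for k v
    by (simp add: f_def abs_mult power_abs)
  have f_eq: "f k v = (indicator {0..1} v * v powr (a - 1) * (1 - v) powr (b - 1)) * ((x * v) ^ k /\<^sub>R fact k)" for k v
  proof (cases "v \<in> {0..1} \<and> v \<noteq> 0")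
    case True
    then have "v powr (a + real k - 1) = v powr (a - 1) * v ^ k"
      by (simp add: powr_realpow[symmetric] powr_add[symmetric] algebra_simps)
    then show ?thesis
      using True by (simp add: f_def power_mult_distrib divide_inverse mult_ac)
    \<comment> \<open>At \<open>v = 0\<close> both sides vanish, also for \<open>k = 0\<close>, because \<open>0 powr _ = 0\<close>.\<close>
  qed (auto simp: f_def indicator_def)
  have sums: "(\<lambda>k. f k v) sums (indicator {0..1} v *\<^sub>R (v powr (a - 1) * (1 - v) powr (b - 1) * exp (x * v)))" for v
    using sums_mult[OF exp_converges[of "x * v"], of "indicator {0..1} v * v powr (a - 1) * (1 - v) powr (b - 1)"]
    by (simp add: f_eq mult_ac)
  have "summable (\<lambda>k. norm (f k v))" for v
  proof -
    have "summable (\<lambda>k. norm (indicator {0..1} v * v powr (a - 1) * (1 - v) powr (b - 1)) * norm ((x * v) ^ k /\<^sub>R fact k))"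
      by (intro summable_mult summable_norm_exp)
    then show ?thesis by (simp add: f_eq abs_mult)
  qed
  then have AE_summable: "AE v in lborel. summable (\<lambda>k. norm (f k v))" by simp
  have int_f: "(LINT v|lborel. f k v) = x ^ k / fact k * Beta (a + real k) b" for k
    using set_integral_Beta[of "a + real k" b] a b by (simp add: f_def set_lebesgue_integral_def)
  have int_norm_f: "(LINT v|lborel. norm (f k v)) = \<bar>x\<bar> ^ k / fact k * Beta (a + real k) b" for k
    unfolding abs_f using set_integral_Beta[of "a + real k" b] a b by (simp add: set_lebesgue_integral_def)
  have summable_int: "summable (\<lambda>k. LINT v|lborel. norm (f k v))"
  proof (rule summable_comparison_test')
    show "summable (\<lambda>k. (\<bar>x\<bar> ^ k /\<^sub>R fact k) * Beta a b)"
      by (intro summable_mult2 summable_exp_generic)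
    fix k :: nat
    have "Beta (a + real k) b \<le> Beta a b" "Beta (a + real k) b \<ge> 0"
      using a b Beta_real_mono[of a "a + real k" b b]
      by (auto simp: Beta_def intro!: divide_nonneg_nonneg mult_nonneg_nonneg less_imp_le[OF Gamma_real_pos])
    moreover from this(1) have "\<bar>x\<bar> ^ k * Beta (a + real k) b \<le> Beta a b * \<bar>x\<bar> ^ k"
      by (subst mult.commute[of "Beta a b"]) (rule mult_left_mono, simp_all)
    ultimately show "norm (LINT v|lborel. norm (f k v)) \<le> (\<bar>x\<bar> ^ k /\<^sub>R fact k) * Beta a b"
      unfolding int_norm_f by (simp add: abs_mult divide_inverse mult.commute)
  qed
  have "integrable lborel (\<lambda>v. \<Sum>k. f k v)"
    by (rule integrable_suminf[OF int AE_summable summable_int])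
  then show "set_integrable lborel {0..1} (\<lambda>v. v powr (a - 1) * (1 - v) powr (b - 1) * exp (x * v))"
    using sums by (simp add: sums_iff set_integrable_def)
  have "(LINT v:{0..1}|lborel. v powr (a - 1) * (1 - v) powr (b - 1) * exp (x * v)) = (LINT v|lborel. (\<Sum>k. f k v))"
    using sums by (simp add: sums_iff set_lebesgue_integral_def)
  also have "(\<lambda>k. LINT v|lborel. f k v) sums \<dots>"
    by (rule sums_integral[OF int AE_summable summable_int])
  then have "(LINT v|lborel. (\<Sum>k. f k v)) = (\<Sum>k. x ^ k / fact k * Beta (a + real k) b)"
    by (simp add: int_f sums_iff)
  also have "\<dots> = (\<Sum>k. Beta a b * (pochhammer a k / pochhammer (a + b) k * x ^ k / fact k))"
    using a b by (simp add: Beta_plus_of_nat_left mult_ac)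
  also have "\<dots> = Beta a b * hypergeom_1F1 a (a + b) x"
  proof -
    have "Beta a b \<noteq> 0"
      using a b by (auto simp: Beta_def Gamma_eq_zero_iff elim!: nonpos_Ints_cases)
    moreover have "summable (\<lambda>k. Beta a b * (pochhammer a k / pochhammer (a + b) k * x ^ k / fact k))"
      using summable_integral[OF int AE_summable summable_int] a b by (simp add: int_f Beta_plus_of_nat_left mult_ac)
    ultimately have "summable (\<lambda>k. pochhammer a k / pochhammer (a + b) k * x ^ k / fact k)"
      by (rule summable_mult_D[rotated])
    then show ?thesis
      unfolding hypergeom_1F1_def by (rule suminf_mult)
  qed
  finally show "(LINT v:{0..1}|lborel. v powr (a - 1) * (1 - v) powr (b - 1) * exp (x * v)) =
      Beta a b * hypergeom_1F1 a (a + b) x" .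
qed

section \<open>Poles of the integrand and the contour\<close>

lemma is_pole_Gamma_shift_iff: "is_pole (\<lambda>s. Gamma (w + s)) s \<longleftrightarrow> w + s \<in> \<int>\<^sub>\<le>\<^sub>0" for w s :: complex
proof
  assume pole: "is_pole (\<lambda>s. Gamma (w + s)) s"
  show "w + s \<in> \<int>\<^sub>\<le>\<^sub>0"
  proof (rule ccontr)
    assume "w + s \<notin> \<int>\<^sub>\<le>\<^sub>0"
    then have "isCont (\<lambda>s. Gamma (w + s)) s"
      by (intro continuous_intros)
    then show False
      using pole not_tendsto_and_filterlim_at_infinity[of "at s"] by (auto simp: isCont_def is_pole_def)
  qed
next
  assume "w + s \<in> \<int>\<^sub>\<le>\<^sub>0"
  then obtain n where n: "w + s = - of_nat n"
    by (auto elim!: nonpos_Ints_cases')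
  have "filterlim (\<lambda>s. w + s) (at (w + s)) (at s)"
    by (auto simp: filterlim_at eventually_at_filter intro!: tendsto_intros)
  with is_pole_Gamma[of n] show "is_pole (\<lambda>s. Gamma (w + s)) s"
    unfolding is_pole_def n by (rule filterlim_compose)
qed

lemma is_pole_Gamma_reflect_iff: "is_pole (\<lambda>s. Gamma (w - s)) s \<longleftrightarrow> w - s \<in> \<int>\<^sub>\<le>\<^sub>0" for w s :: complex
proof -
  have "is_pole (\<lambda>s. Gamma (w - s)) s \<longleftrightarrow> is_pole (\<lambda>s. Gamma (w + s)) (- s)"
  proof -
    have *: "filterlim (\<lambda>s::complex. - s) (at (- x)) (at x)" for x
      by (auto simp: filterlim_at eventually_at_filter intro!: tendsto_intros)
    show ?thesis
      unfolding is_pole_def using filterlim_compose[OF _ *[of s], of "\<lambda>s. Gamma (w + s)"]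
        filterlim_compose[OF _ *[of "- s"], of "\<lambda>s. Gamma (w - s)"] by auto
  qed
  then show ?thesis by (simp add: is_pole_Gamma_shift_iff)
qed

text \<open>The abscissa in \<open>meijer_G\<close> is an arbitrary choice, so all that is known about it is that it
separates the poles; the pole of each gamma factor closest to the line bounds it on one side.\<close>

lemma separates_poles_1_1_iff:
  fixes a b b' :: complex
  shows "separates_poles 1 1 [a] [b, b'] \<kappa> \<longleftrightarrow> - Re b < \<kappa> \<and> \<kappa> < 1 - Re a"
proof
  assume "separates_poles 1 1 [a] [b, b'] \<kappa>"
  then have "Re (- b) < \<kappa>" "\<kappa> < Re (1 - a)"
    by (auto simp: separates_poles_def is_pole_Gamma_shift_iff is_pole_Gamma_reflect_iff
        dest: spec[of _ "- b"] spec[of _ "1 - a"])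
  then show "- Re b < \<kappa> \<and> \<kappa> < 1 - Re a" by simp
next
  assume *: "- Re b < \<kappa> \<and> \<kappa> < 1 - Re a"
  have "Re w \<le> 0" if "w \<in> \<int>\<^sub>\<le>\<^sub>0" for w :: complex
    using that by (auto elim!: nonpos_Ints_cases)
  from this[of "b + s" for s] this[of "1 - a - s" for s] * show "separates_poles 1 1 [a] [b, b'] \<kappa>"
    by (force simp: separates_poles_def is_pole_Gamma_shift_iff is_pole_Gamma_reflect_iff)
qed

section \<open>The G-function\<close>

text \<open>The only condition linking \<open>\<alpha>\<close> and \<open>\<gamma>\<close> is that a separating abscissa exists; the value of the integral
does not depend on it, because \<open>Mellin_Barnes_integral\<close> holds on every line between the two families of poles.\<close>

lemma meijer_G_eq_integral:
  fixes \<alpha> \<beta> \<gamma> z :: real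
  assumes "- \<gamma> < 2 + \<alpha>" and "\<beta> > 0" and "z > 0"
  shows "meijer_G 1 1 [of_real (-1 - \<alpha>)] [of_real \<gamma>, of_real (-1 - \<alpha> - \<beta>)] z =
    of_real (z powr \<gamma> / Gamma \<beta> *
      (LINT v:{0..1}|lborel. v powr (\<alpha> + \<gamma> + 1) * (1 - v) powr (\<beta> - 1) * exp (- z * v)))"
proof -
  let ?sep = "separates_poles 1 1 [of_real (-1 - \<alpha>)] [of_real \<gamma>, of_real (-1 - \<alpha> - \<beta>)]"
  define \<kappa> where "\<kappa> = (SOME \<kappa>. ?sep \<kappa>)"
  define I where "I = z powr \<gamma> / Gamma \<beta> *
      (LINT v:{0..1}|lborel. v powr (\<alpha> + \<gamma> + 1) * (1 - v) powr (\<beta> - 1) * exp (- z * v))"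
  define F where "F = (\<lambda>s. Gamma (of_real \<gamma> + s) * Gamma (of_real (2 + \<alpha>) - s) /
      Gamma (of_real (2 + \<alpha> + \<beta>) - s) * complex_of_real z powr (- s))"
  obtain \<kappa>' where "- \<gamma> < \<kappa>'" "\<kappa>' < 2 + \<alpha>"
    using dense[OF assms(1)] by blast
  then have "?sep \<kappa>'"
    unfolding separates_poles_1_1_iff by simp
  then have "?sep \<kappa>"
    unfolding \<kappa>_def by (rule someI)
  then have \<kappa>: "- \<gamma> < \<kappa>" "\<kappa> < 2 + \<alpha>"
    unfolding separates_poles_1_1_iff by simp_all
  have integrand: "meijer_integrand 1 1 [of_real (-1 - \<alpha>)] [of_real \<gamma>, of_real (-1 - \<alpha> - \<beta>)] z s = F s" for s
  proof -
    have "1 - of_real (-1 - \<alpha>) - s = of_real (2 + \<alpha>) - s"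
      and "1 - of_real (-1 - \<alpha> - \<beta>) - s = of_real (2 + \<alpha> + \<beta>) - s"
      by simp_all
    moreover have "{1..<length [complex_of_real \<gamma>, of_real (-1 - \<alpha> - \<beta>)]} = {1}" by auto
    ultimately show ?thesis
      unfolding meijer_integrand_def F_def by (simp del: of_real_diff of_real_add)
  qed
  have "has_bochner_integral lborel (\<lambda>t. F (Complex \<kappa> t)) (of_real (2 * pi * I))"
    using Mellin_Barnes_integral[OF \<kappa> assms(2,3)] unfolding F_def I_def .
  then have "has_bochner_integral lborel (\<lambda>t. F (Complex \<kappa> t) * \<i>) (of_real (2 * pi * I) * \<i>)"
    by (intro has_bochner_integral_mult_left)
  then have "vertical_line_integral F \<kappa> = of_real (2 * pi * I) * \<i>"
    unfolding vertical_line_integral_def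
    by (subst integral_lborel) (auto simp: has_bochner_integral_iff)
  then have "meijer_G 1 1 [of_real (-1 - \<alpha>)] [of_real \<gamma>, of_real (-1 - \<alpha> - \<beta>)] z = of_real I"
    unfolding meijer_G_def \<kappa>_def[symmetric] integrand[abs_def] by simp
  then show ?thesis by (simp only: I_def)
qed

lemma integral_Icc_scale_to_unit:
  fixes p q a u :: real
  assumes u: "u > 0"
  shows "integral {0..u} (\<lambda>v. v powr p * (u - v) powr q * exp (- a * v)) =
    u powr (p + q + 1) * integral {0..1} (\<lambda>v. v powr p * (1 - v) powr q * exp (- a * u * v))"
proof -
  define f where "f = (\<lambda>v. v powr p * (u - v) powr q * exp (- a * v))"
  define g where "g = (\<lambda>v. v powr p * (1 - v) powr q * exp (- a * u * v))"
  have fg: "f (u * v) = u powr (p + q) * g v" if "v \<in> {0..1}" for v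
  proof -
    have "u - u * v = u * (1 - v)" by (simp add: algebra_simps)
    then show ?thesis
      using that u by (simp add: f_def g_def powr_mult powr_add mult_ac)
  qed
  have iff: "(f has_integral I) {0..u} \<longleftrightarrow> (g has_integral (I / u powr (p + q + 1))) {0..1}" for I
  proof -
    have "(f has_integral I) {0..u} \<longleftrightarrow> ((\<lambda>v. f (u * v)) has_integral (I / u)) {0..1}"
      using has_integral_affinity_iff[OF u, of f 0 I 0 u] u by (simp add: field_simps)
    also have "\<dots> \<longleftrightarrow> ((\<lambda>v. u powr (p + q) *\<^sub>R g v) has_integral (I / u)) {0..1}"
      by (rule has_integral_cong) (simp add: fg)
    also have "\<dots> \<longleftrightarrow> (g has_integral ((I / u) /\<^sub>R u powr (p + q))) {0..1}"
      using u by (intro has_integral_cmul_iff') simp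
    also have "(I / u) /\<^sub>R u powr (p + q) = I / u powr (p + q + 1)"
      using u by (simp add: powr_add field_simps)
    finally show ?thesis .
  qed
  have "integral {0..u} f = u powr (p + q + 1) * integral {0..1} g"
  proof (cases "g integrable_on {0..1}")
    case True
    then have "(f has_integral (u powr (p + q + 1) * integral {0..1} g)) {0..u}"
      using u by (subst iff) (simp add: integrable_integral)
    then show ?thesis by (rule integral_unique)
  next
    case False
    then have "\<not> f integrable_on {0..u}"
      using iff by (auto simp: integrable_on_def)
    with False show ?thesis by (simp add: not_integrable_integral)
  qed
  then show ?thesis by (simp only: f_def g_def)
qed


theorem theorem3p5:
  fixes \<alpha> \<beta> \<gamma> a u :: real
  assumes "\<alpha> > -1" and "\<gamma> > -1" and "a > 0" and "\<beta> > 0" and "u > 0"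
  shows "meijer_G 1 1 [of_real (-1 - \<alpha>)] [of_real \<gamma>, of_real (-1 - \<alpha> - \<beta>)] (a * u) =
           of_real (a powr \<gamma> / Gamma \<beta> * u powr (- \<beta> - \<alpha> - 1) *
             integral {0..u} (\<lambda>v. v powr (\<alpha> + \<gamma> + 1) * (u - v) powr (\<beta> - 1) * exp (- a * v)))
       \<and> a powr \<gamma> / Gamma \<beta> * u powr (- \<beta> - \<alpha> - 1) *
             integral {0..u} (\<lambda>v. v powr (\<alpha> + \<gamma> + 1) * (u - v) powr (\<beta> - 1) * exp (- a * v))
         = a powr \<gamma> / Gamma \<beta> * u powr \<gamma> *
             integral {0..1} (\<lambda>v. v powr (\<alpha> + \<gamma> + 1) * (1 - v) powr (\<beta> - 1) * exp (- a * u * v))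
       \<and> a powr \<gamma> / Gamma \<beta> * u powr \<gamma> *
             integral {0..1} (\<lambda>v. v powr (\<alpha> + \<gamma> + 1) * (1 - v) powr (\<beta> - 1) * exp (- a * u * v))
         = a powr \<gamma> * (Gamma (2 + \<alpha> + \<gamma>) / Gamma (2 + \<alpha> + \<gamma> + \<beta>)) * u powr \<gamma> *
             hypergeom_1F1 (2 + \<alpha> + \<gamma>) (2 + \<alpha> + \<gamma> + \<beta>) (- a * u)"
proof -
  define J where "J = integral {0..1} (\<lambda>v. v powr (\<alpha> + \<gamma> + 1) * (1 - v) powr (\<beta> - 1) * exp (- a * u * v))"
  define K where "K = integral {0..u} (\<lambda>v. v powr (\<alpha> + \<gamma> + 1) * (u - v) powr (\<beta> - 1) * exp (- a * v))"
  have pos: "2 + \<alpha> + \<gamma> > 0" "a * u > 0" "- \<gamma> < 2 + \<alpha>" "Gamma \<beta> > 0"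
    using assms by (auto intro: Gamma_real_pos)
  have exponent: "2 + \<alpha> + \<gamma> - 1 = \<alpha> + \<gamma> + 1" by simp
  note Euler = Euler_integral_1F1[OF pos(1) \<open>\<beta> > 0\<close>, of "- a * u", unfolded exponent]
  have LINT_eq: "(LINT v:{0..1}|lborel. v powr (\<alpha> + \<gamma> + 1) * (1 - v) powr (\<beta> - 1) * exp (- a * u * v)) = J"
    unfolding J_def by (rule set_borel_integral_eq_integral(2)[OF Euler(1)])
  have "K = u powr (\<alpha> + \<gamma> + 1 + (\<beta> - 1) + 1) * J"
    unfolding K_def J_def by (rule integral_Icc_scale_to_unit[OF \<open>u > 0\<close>])
  then have "u powr (- \<beta> - \<alpha> - 1) * K = u powr (- \<beta> - \<alpha> - 1) * u powr (\<alpha> + \<gamma> + 1 + (\<beta> - 1) + 1) * J"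
    by simp
  also have "u powr (- \<beta> - \<alpha> - 1) * u powr (\<alpha> + \<gamma> + 1 + (\<beta> - 1) + 1) = u powr \<gamma>"
    using powr_add[of u "- \<beta> - \<alpha> - 1" "\<alpha> + \<gamma> + 1 + (\<beta> - 1) + 1"] by simp
  finally have uK: "u powr (- \<beta> - \<alpha> - 1) * K = u powr \<gamma> * J" .
  have KJ: "a powr \<gamma> / Gamma \<beta> * u powr (- \<beta> - \<alpha> - 1) * K = a powr \<gamma> / Gamma \<beta> * u powr \<gamma> * J"
    by (simp only: mult.assoc uK)
  have "meijer_G 1 1 [of_real (-1 - \<alpha>)] [of_real \<gamma>, of_real (-1 - \<alpha> - \<beta>)] (a * u) = of_real ((a * u) powr \<gamma> / Gamma \<beta> * J)"
    using meijer_G_eq_integral[OF pos(3) \<open>\<beta> > 0\<close> pos(2)] LINT_eq by (simp only: mult_minus_left)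
  also have "(a * u) powr \<gamma> / Gamma \<beta> * J = a powr \<gamma> / Gamma \<beta> * u powr \<gamma> * J"
    using assms by (simp add: powr_mult)
  finally have G: "meijer_G 1 1 [of_real (-1 - \<alpha>)] [of_real \<gamma>, of_real (-1 - \<alpha> - \<beta>)] (a * u) =
      of_real (a powr \<gamma> / Gamma \<beta> * u powr (- \<beta> - \<alpha> - 1) * K)"
    by (simp only: KJ)
  have "J = Beta (2 + \<alpha> + \<gamma>) \<beta> * hypergeom_1F1 (2 + \<alpha> + \<gamma>) (2 + \<alpha> + \<gamma> + \<beta>) (- a * u)"
    using Euler(2) LINT_eq by simp
  then have "a powr \<gamma> / Gamma \<beta> * u powr \<gamma> * J =
      a powr \<gamma> * (Gamma (2 + \<alpha> + \<gamma>) / Gamma (2 + \<alpha> + \<gamma> + \<beta>)) * u powr \<gamma> *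
             hypergeom_1F1 (2 + \<alpha> + \<gamma>) (2 + \<alpha> + \<gamma> + \<beta>) (- a * u)"
    using pos(4) by (simp add: Beta_def)
  with G KJ show ?thesis
    unfolding J_def K_def by blast
qed

end
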